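(* Let $G$ be a $(d,s)$-edge colorable graph of order $n$, let $h$ be a standard coloring of $G$ with colors $\{1,\dots,d\}$, and let $L$ be a $\beta$-sparse list assignment for $G$ (with respect to $h$). If $s \geq 11$ and $\beta \leq 2^{-11}\, s\, d^{-1}\, (2n)^{-2^9 d s^{-2}}$, then there is a proper $d$-edge coloring $\varphi$ of $G$ (with colors $\{1,\dots,d\}$) which avoids $L$, i.e. $\varphi(e)\notin L(e)$ for every edge $e$ of $G$.
   Context: Graphs are finite and simple; the order of a graph is its number of vertices. A cycle in an edge-colored graph is $2$-colored if its edges are properly colored by two distinct colors (so a $4$-cycle is $2$-colored if its edges alternate between two distinct colors). For integers $d,s$, a $d$-regular graph $G$ is $(d,s)$-edge colorable if it admits a proper $d$-edge coloring $h$ in which every edge of $G$ is contained in at least $s-1$ $2$-colored $4$-cycles (necessarily $s\le d$). Such a coloring $h$ is called a standard coloring; it is fixed and uses the colors $\{1,\dots,d\}$. A standard matching of $G$ is a maximum set of edges all having the same color under $h$, i.e. a color class of $h$. The distance between two edges $e,e'$ is the number of edges in a shortest path between an endpoint of $e$ and an endpoint of $e'$. The $t$-neighborhood of an edge $e$ is the graph induced by all edges at distance at most $t$ from $e$. A list assignment $L$ for $G$ (assigning to each edge $e$ a possibly empty set $L(e)\subseteq\{1,\dots,d\}$ of forbidden colors) is $\beta$-sparse if (i) $|L(e)|\le \beta s$ for each edge $e$; (ii) for every vertex $v$, each color in $\{1,\dots,d\}$ occurs in at most $\beta s$ lists of edges incident to $v$; (iii) for every $6$-neighborhood $W$ (of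 any edge) and every standard matching $M$, any color appears at most $\beta s$ times in lists of edges of $M$ contained in $W$. *)

theory Defs
  imports Complex_Main "HOL-Library.Extended_Nat"
begin

text \<open>A graph is a vertex set \<open>V\<close> together with an edge set \<open>E\<close> whose members are two-element
  subsets of \<open>V\<close>. The order of the graph is \<open>card V\<close>.\<close>

definition simple_graph :: "'a set \<Rightarrow> 'a set set \<Rightarrow> bool" where
  "simple_graph V E \<longleftrightarrow> finite V \<and> E \<subseteq> {e. e \<subseteq> V \<and> card e = 2}"

definition incident_edges :: "'a set set \<Rightarrow> 'a \<Rightarrow> 'a set set" where
  "incident_edges E v = {e \<in> E. v \<in> e}"

definition regular :: "'a set \<Rightarrow> 'a set set \<Rightarrow> nat \<Rightarrow> bool" where
  "regular V E d \<longleftrightarrow> (\<forall>v\<in>V. card (incident_edges E v) = d)"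

definition properly_colored :: "'a set set \<Rightarrow> ('a set \<Rightarrow> nat) \<Rightarrow> bool" where
  "properly_colored E h \<longleftrightarrow> (\<forall>e\<in>E. \<forall>e'\<in>E. e \<noteq> e' \<longrightarrow> e \<inter> e' \<noteq> {} \<longrightarrow> h e \<noteq> h e')"

definition proper_edge_coloring :: "'a set set \<Rightarrow> nat \<Rightarrow> ('a set \<Rightarrow> nat) \<Rightarrow> bool" where
  "proper_edge_coloring E d h \<longleftrightarrow> (\<forall>e\<in>E. h e \<in> {1..d}) \<and> properly_colored E h"

text \<open>A cycle is identified with its edge set, so that the same cycle traversed from different
  starting points or in different directions is counted once.\<close>

definition is_cycle :: "'a set set \<Rightarrow> nat \<Rightarrow> 'a set set \<Rightarrow> bool" where
  "is_cycle E k C \<longleftrightarrow> C \<subseteq> E \<and> k \<ge> 3 \<and>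
     (\<exists>xs. length xs = k \<and> distinct xs \<and> C = {{xs ! i, xs ! (Suc i mod k)} |i. i < k})"

definition two_colored :: "('a set \<Rightarrow> nat) \<Rightarrow> 'a set set \<Rightarrow> bool" where
  "two_colored h C \<longleftrightarrow> properly_colored C h \<and> card (h ` C) = 2"

definition standard_coloring :: "'a set set \<Rightarrow> nat \<Rightarrow> nat \<Rightarrow> ('a set \<Rightarrow> nat) \<Rightarrow> bool" where
  "standard_coloring E d s h \<longleftrightarrow> proper_edge_coloring E d h \<and>
     (\<forall>e\<in>E. card {C. is_cycle E 4 C \<and> two_colored h C \<and> e \<in> C} \<ge> s - 1)"

definition edge_colorable :: "'a set \<Rightarrow> 'a set set \<Rightarrow> nat \<Rightarrow> nat \<Rightarrow> bool" where
  "edge_colorable V E d s \<longleftrightarrow> regular V E d \<and> (\<exists>h. standard_coloring E d s h)"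

definition standard_matching ::
    "'a set set \<Rightarrow> nat \<Rightarrow> ('a set \<Rightarrow> nat) \<Rightarrow> 'a set set \<Rightarrow> bool" where
  "standard_matching E d h M \<longleftrightarrow> (\<exists>c\<in>{1..d}. M = {e \<in> E. h e = c})"

text \<open>Paths are nonempty lists of distinct vertices; the number of edges of \<open>p\<close> is
  \<open>length p - 1\<close>.\<close>

definition is_path :: "'a set set \<Rightarrow> 'a list \<Rightarrow> bool" where
  "is_path E p \<longleftrightarrow> p \<noteq> [] \<and> distinct p \<and> (\<forall>i. Suc i < length p \<longrightarrow> {p ! i, p ! Suc i} \<in> E)"

text \<open>The distance is \<open>\<infinity>\<close> (infimum of the empty set) for edges in different components.\<close>

definition edge_dist :: "'a set set \<Rightarrow> 'a set \<Rightarrow> 'a set \<Rightarrow> enat" where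
  "edge_dist E e e' =
     (INF p\<in>{p. is_path E p \<and> hd p \<in> e \<and> last p \<in> e'}. enat (length p - 1))"

text \<open>The subgraph induced by a set of edges has exactly these edges and their endpoints, so it is
  represented by its edge set.\<close>

definition edge_nbhd :: "'a set set \<Rightarrow> nat \<Rightarrow> 'a set \<Rightarrow> 'a set set" where
  "edge_nbhd E t e = {e' \<in> E. edge_dist E e e' \<le> enat t}"

definition list_assignment :: "'a set set \<Rightarrow> nat \<Rightarrow> ('a set \<Rightarrow> nat set) \<Rightarrow> bool" where
  "list_assignment E d L \<longleftrightarrow> (\<forall>e\<in>E. L e \<subseteq> {1..d})"

definition beta_sparse ::
    "'a set \<Rightarrow> 'a set set \<Rightarrow> nat \<Rightarrow> nat \<Rightarrow> ('a set \<Rightarrow> nat) \<Rightarrow> real \<Rightarrow> ('a set \<Rightarrow> nat set) \<Rightarrow> bool" where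
  "beta_sparse V E d s h \<beta> L \<longleftrightarrow>
     (\<forall>e\<in>E. real (card (L e)) \<le> \<beta> * real s) \<and>
     (\<forall>v\<in>V. \<forall>c\<in>{1..d}. real (card {e \<in> incident_edges E v. c \<in> L e}) \<le> \<beta> * real s) \<and>
     (\<forall>e\<in>E. \<forall>M. standard_matching E d h M \<longrightarrow>
        (\<forall>c\<in>{1..d}. real (card {e' \<in> M \<inter> edge_nbhd E 6 e. c \<in> L e'}) \<le> \<beta> * real s))"

definition avoids :: "'a set set \<Rightarrow> ('a set \<Rightarrow> nat) \<Rightarrow> ('a set \<Rightarrow> nat set) \<Rightarrow> bool" where
  "avoids E \<phi> L \<longleftrightarrow> (\<forall>e\<in>E. \<phi> e \<notin> L e)"

end

theory Submission
  imports Defs "HOL-Combinatorics.Permutations" "HOL-Library.FuncSet"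
begin

text \<open>
  Permute the colours of \<open>h\<close> by a random \<open>\<rho>\<close> and call an edge conflicting if its new colour is
  forbidden. Put \<open>x = s\<^sup>2 / d\<close>; unless all lists are empty, \<open>\<beta> s \<ge> 1\<close> and hence \<open>x \<ge> 2048\<close>. A union
  bound over all vertices and edges yields a \<open>\<rho>\<close> for which every vertex meets fewer than
  \<open>k = \<lceil>x / 64\<rceil>\<close> conflicting edges and, for every edge \<open>e\<close>, fewer than \<open>k\<close> of the two-coloured
  4-cycles through \<open>e\<close> would put a forbidden colour on the edge opposite to \<open>e\<close>.

  With \<open>b = \<lfloor>\<beta> s\<rfloor>\<close>, each conflicting edge then lies on at least \<open>s - 1 - 5 b - 3 k\<close> two-coloured
  4-cycles that contain no other conflicting edge and on which interchanging the two colours leaves no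
  conflict. Each of them shares an edge with at most \<open>6 (k + b)\<close> of the cycles available to other
  conflicting edges. As this is at most a quarter of the number of available cycles, one can select
  pairwise edge-disjoint cycles, one per conflicting edge, and interchange the colours on all of them.
\<close>

subsection \<open>Permutations with few hits\<close>

text \<open>Peeling off one prescribed position \<open>a\<close> leaves at most \<open>b\<close>
  choices for its value \<open>y\<close>, followed by a permutation of the remaining elements with
  target sets that are no larger.\<close>

lemma card_permutations_hitting:
  fixes A :: "'a \<Rightarrow> 'a set"
  assumes "finite S" "K \<subseteq> S" "\<And>c. c \<in> K \<Longrightarrow> finite (A c) \<and> card (A c) \<le> b"
  shows "card {\<rho>. \<rho> permutes S \<and> (\<forall>c\<in>K. \<rho> c \<in> A c)} \<le> b ^ card K * fact (card S - card K)"
proof -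
  have "finite K"
    using assms finite_subset by blast
  from this assms show ?thesis
  proof (induction K arbitrary: S A rule: finite_induct)
    case empty
    then show ?case by (simp add: card_permutations)
  next
    case (insert a K S A)
    define S' where "S' = S - {a}"
    have S: "S = insert a S'" "a \<notin> S'" "finite S'" "K \<subseteq> S'"
      using insert.prems insert.hyps by (auto simp: S'_def)
    \<comment> \<open>A permutation is written as \<open>transpose a y \<circ> p\<close> with
      \<open>p\<close> fixing \<open>a\<close>. The targets at the other positions are moved by the
      same transposition, which is why the induction runs over arbitrary \<open>A\<close>.\<close>
    define B where "B y = {p. p permutes S' \<and> (\<forall>c\<in>K. p c \<in> transpose a y ` A c)}" for y
    have finB: "finite (B y)" for y
      unfolding B_def using finite_permutations[OF S(3)] by simp
    have cardB: "card (B y) \<le> b ^ card K * fact (card S' - card K)" for y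
      unfolding B_def
    proof (rule insert.IH[OF S(3,4)])
      fix c assume "c \<in> K"
      then show "finite (transpose a y ` A c) \<and> card (transpose a y ` A c) \<le> b"
        using insert.prems(3)[of c] card_image_le[of "A c" "transpose a y"] by auto
    qed
    have fin: "finite (Sigma (A a) B)"
      using insert.prems(3)[of a] finB by auto
    have "{\<rho>. \<rho> permutes S \<and> (\<forall>c\<in>insert a K. \<rho> c \<in> A c)}
        \<subseteq> (\<lambda>(y, p). transpose a y \<circ> p) ` Sigma (A a) B"
    proof
      fix \<rho> assume "\<rho> \<in> {\<rho>. \<rho> permutes S \<and> (\<forall>c\<in>insert a K. \<rho> c \<in> A c)}"
      then have \<rho>: "\<rho> permutes insert a S'" "\<And>c. c \<in> insert a K \<Longrightarrow> \<rho> c \<in> A c"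
        using S by auto
      define y p where "y = \<rho> a" and "p = transpose a y \<circ> \<rho>"
      have yp: "\<rho> = transpose a y \<circ> p" "p permutes S'"
        using permutes_insert_lemma[OF \<rho>(1)] by (simp_all add: y_def p_def comp_assoc[symmetric])
      have "\<rho> a = y"
        using yp S(2) by (simp add: permutes_not_in)
      moreover have "p c \<in> transpose a y ` A c" if "c \<in> K" for c
        using \<rho>(2)[of c] that yp(1) by (intro image_eqI[of _ _ "\<rho> c"]) auto
      ultimately show "\<rho> \<in> (\<lambda>(y, p). transpose a y \<circ> p) ` Sigma (A a) B"
        using \<rho>(2)[of a] yp by (intro image_eqI[of _ _ "(y, p)"]) (auto simp: B_def)
    qed
    then have "card {\<rho>. \<rho> permutes S \<and> (\<forall>c\<in>insert a K. \<rho> c \<in> A c)} \<le> card (Sigma (A a) B)"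
      using fin by (rule surj_card_le[rotated])
    also have "\<dots> = (\<Sum>y\<in>A a. card (B y))"
      using insert.prems(3)[of a] finB by (intro card_SigmaI) auto
    also have "\<dots> \<le> (\<Sum>y\<in>A a. b ^ card K * fact (card S' - card K))"
      using cardB by (rule sum_mono)
    also have "\<dots> \<le> b * (b ^ card K * fact (card S' - card K))"
      using insert.prems(3)[of a] by simp
    finally show ?case
      using insert.hyps S by simp
  qed
qed

text \<open>Union bound over the \<open>k\<close>-subsets of positions: the binomial coefficient
  cancels against the factorials, so \<open>k\<close> or more hits have probability at most
  \<open>b ^ k / fact k\<close>. The factor \<open>fact k\<close> on the left avoids the
  division.\<close>

lemma card_permutations_many_hits:
  fixes A :: "'a \<Rightarrow> 'a set"
  assumes "finite S" "\<And>c. c \<in> S \<Longrightarrow> finite (A c) \<and> card (A c) \<le> b"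
  shows "card {\<rho>. \<rho> permutes S \<and> k \<le> card {c \<in> S. \<rho> c \<in> A c}} * fact k \<le> b ^ k * fact (card S)"
proof -
  define Q where "Q K = {\<rho>. \<rho> permutes S \<and> (\<forall>c\<in>K. \<rho> c \<in> A c)}" for K
  define \<K> where "\<K> = {K. K \<subseteq> S \<and> card K = k}"
  have fin: "finite \<K>" "finite (Q K)" for K
    using assms finite_permutations[OF assms(1)] by (auto simp: \<K>_def Q_def)
  have "{\<rho>. \<rho> permutes S \<and> k \<le> card {c \<in> S. \<rho> c \<in> A c}} \<subseteq> (\<Union>K\<in>\<K>. Q K)"
  proof
    fix \<rho> assume "\<rho> \<in> {\<rho>. \<rho> permutes S \<and> k \<le> card {c \<in> S. \<rho> c \<in> A c}}"
    then have \<rho>: "\<rho> permutes S" "k \<le> card {c \<in> S. \<rho> c \<in> A c}" by auto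
    obtain K where "K \<subseteq> {c \<in> S. \<rho> c \<in> A c}" "card K = k"
      using obtain_subset_with_card_n[OF \<rho>(2)] by blast
    then show "\<rho> \<in> (\<Union>K\<in>\<K>. Q K)"
      using \<rho> by (auto simp: \<K>_def Q_def)
  qed
  then have "card {\<rho>. \<rho> permutes S \<and> k \<le> card {c \<in> S. \<rho> c \<in> A c}} \<le> card (\<Union>K\<in>\<K>. Q K)"
    using fin by (intro card_mono) auto
  also have "\<dots> \<le> (\<Sum>K\<in>\<K>. card (Q K))"
    using fin by (intro card_UN_le) auto
  also have "\<dots> \<le> (\<Sum>K\<in>\<K>. b ^ k * fact (card S - k))"
  proof (rule sum_mono)
    fix K assume "K \<in> \<K>"
    then show "card (Q K) \<le> b ^ k * fact (card S - k)"
      using card_permutations_hitting[of S K A b] assms by (auto simp: \<K>_def Q_def)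
  qed
  also have "\<dots> = (card S choose k) * (b ^ k * fact (card S - k))"
    using n_subsets[OF assms(1)] by (simp add: \<K>_def)
  finally have "card {\<rho>. \<rho> permutes S \<and> k \<le> card {c \<in> S. \<rho> c \<in> A c}} * fact k
      \<le> (card S choose k) * (b ^ k * fact (card S - k)) * fact k"
    by (rule mult_right_mono) simp
  also have "\<dots> \<le> b ^ k * fact (card S)"
  proof (cases "k \<le> card S")
    case True
    have "(card S choose k) * (b ^ k * fact (card S - k)) * fact k
        = b ^ k * (fact k * fact (card S - k) * (card S choose k))"
      by (simp add: mult_ac)
    then show ?thesis
      by (simp only: binomial_fact_lemma[OF True])
  qed (simp add: binomial_eq_0)
  finally show ?thesis .
qed

text \<open>Each index spoils at most a fraction \<open>b ^ k / fact k\<close> of all permutations,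
  and these fractions sum to less than 1.\<close>

lemma ex_permutation_few_hits:
  fixes A :: "'i \<Rightarrow> 'a \<Rightarrow> 'a set"
  assumes "finite S" "finite I"
    and "\<And>i c. i \<in> I \<Longrightarrow> c \<in> S \<Longrightarrow> finite (A i c) \<and> card (A i c) \<le> b"
    and "card I * b ^ k < fact k"
  shows "\<exists>\<rho>. \<rho> permutes S \<and> (\<forall>i\<in>I. card {c \<in> S. \<rho> c \<in> A i c} < k)"
proof (rule ccontr)
  assume no: "\<not> ?thesis"
  define B where "B i = {\<rho>. \<rho> permutes S \<and> k \<le> card {c \<in> S. \<rho> c \<in> A i c}}" for i
  have finB: "finite (B i)" for i
    using finite_permutations[OF assms(1)] by (simp add: B_def)
  have "{\<rho>. \<rho> permutes S} \<subseteq> (\<Union>i\<in>I. B i)"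
    using no by (force simp: B_def not_less)
  then have "card {\<rho>. \<rho> permutes S} \<le> card (\<Union>i\<in>I. B i)"
    using assms finB by (intro card_mono) auto
  also have "\<dots> \<le> (\<Sum>i\<in>I. card (B i))"
    using assms by (intro card_UN_le) auto
  finally have "fact (card S) * fact k \<le> (\<Sum>i\<in>I. card (B i)) * fact k"
    using card_permutations[OF refl assms(1)] by simp
  also have "\<dots> = (\<Sum>i\<in>I. card (B i) * fact k)"
    by (simp add: sum_distrib_right)
  also have "\<dots> \<le> (\<Sum>i\<in>I. b ^ k * fact (card S))"
    unfolding B_def by (intro sum_mono card_permutations_many_hits) (use assms in auto)
  also have "\<dots> = card I * b ^ k * fact (card S)"
    by simp
  also have "\<dots> < fact k * fact (card S)"
    using assms(4) by (intro mult_strict_right_mono) auto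
  finally show False by simp
qed

subsection \<open>Independent transversals\<close>

text \<open>Rosenfeld's counting argument: adding an index multiplies the number of independent
  transversals by at least \<open>p / 2\<close>. By induction, fixing the choice at one of the old indices leaves
  at most a fraction \<open>2 / p\<close> of the transversals, so at most \<open>2 \<Delta> / p \<le> 1 / 2\<close> of them clash with a
  given choice at the new index.\<close>

lemma ex_independent_transversal:
  fixes P :: "'i \<Rightarrow> 'c set" and R :: "'i \<times> 'c \<Rightarrow> 'i \<times> 'c \<Rightarrow> bool"
  assumes "finite I"
    and finP: "\<And>i. i \<in> I \<Longrightarrow> finite (P i)"
    and cardP: "\<And>i. i \<in> I \<Longrightarrow> p \<le> card (P i)"
    and sym: "\<And>x y. R x y \<Longrightarrow> R y x"
    and deg: "\<And>i a. i \<in> I \<Longrightarrow> a \<in> P i \<Longrightarrow>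
       card {(j, b). j \<in> I - {i} \<and> b \<in> P j \<and> R (i, a) (j, b)} \<le> \<Delta>"
    and "4 * \<Delta> \<le> p" "0 < p"
  shows "\<exists>f. \<forall>i\<in>I. f i \<in> P i \<and> (\<forall>j\<in>I. i \<noteq> j \<longrightarrow> \<not> R (i, f i) (j, f j))"
proof -
  \<comment> \<open>\<open>PiE\<close> fixes the values outside \<open>S\<close>, so the functions
    to be counted are finitely many and each transversal counts once.\<close>
  define T where
    "T S = {f \<in> PiE S P. \<forall>i\<in>S. \<forall>j\<in>S. i \<noteq> j \<longrightarrow> \<not> R (i, f i) (j, f j)}" for S
  have finT: "finite (T S)" if "S \<subseteq> I" for S
  proof (rule finite_subset)
    show "T S \<subseteq> PiE S P" by (auto simp: T_def)
    show "finite (PiE S P)"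
      by (rule finite_PiE) (use that finP finite_subset[OF that assms(1)] in auto)
  qed
  have growth: "p * card (T S) \<le> 2 * card (T (insert i S))" if "insert i S \<subseteq> I" "i \<notin> S" for i S
    using that
  proof (induction "card S" arbitrary: i S rule: less_induct)
    case less
    have S: "S \<subseteq> I" "i \<in> I" using less.prems by auto
    have finS: "finite S" using S(1) assms(1) by (rule finite_subset)
    define ext where "ext a = {f \<in> T S. \<forall>j\<in>S. \<not> R (i, a) (j, f j)}" for a
    have finext: "finite (ext a)" for a
      using finT[OF S(1)] by (simp add: ext_def)
    have half: "card (T S) \<le> 2 * card (ext a)" if a: "a \<in> P i" for a
    proof -
      define D where "D = {(j, b). j \<in> S \<and> b \<in> P j \<and> R (i, a) (j, b)}"
      have D_sub: "D \<subseteq> Sigma I P" using S by (auto simp: D_def)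
      have finD: "finite D"
        by (rule finite_subset[OF D_sub]) (use assms finP in auto)
      have "D \<subseteq> {(j, b). j \<in> I - {i} \<and> b \<in> P j \<and> R (i, a) (j, b)}"
        using S less.prems(2) by (auto simp: D_def)
      moreover have "finite {(j, b). j \<in> I - {i} \<and> b \<in> P j \<and> R (i, a) (j, b)}"
        by (rule finite_subset[of _ "Sigma I P"]) (use assms finP in auto)
      ultimately have cardD: "card D \<le> \<Delta>"
        using deg[OF S(2) a] card_mono by (metis (no_types, lifting) order_trans)
      define H where "H = (\<lambda>(j, b). {f \<in> T S. f j = b})"
      have H: "p * card (H x) \<le> 2 * card (T S)" if x: "x \<in> D" for x
      proof -
        obtain j b where jb: "x = (j, b)" "j \<in> S" "b \<in> P j"
          using x by (auto simp: D_def)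
        \<comment> \<open>With the value at \<open>j\<close> prescribed, forgetting it is injective
          and leads to transversals of \<open>S - {j}\<close>. The induction hypothesis for adding
          \<open>j\<close> back then bounds their number.\<close>
        have "inj_on (\<lambda>f. restrict f (S - {j})) (H x)"
        proof (rule inj_onI)
          fix f g assume f: "f \<in> H x" and g: "g \<in> H x"
            and eq: "restrict f (S - {j}) = restrict g (S - {j})"
          have "f y = g y" if "y \<in> S" for y
            using fun_cong[OF eq, of y] f g that jb by (cases "y = j") (auto simp: H_def)
          moreover have "f \<in> PiE S P" "g \<in> PiE S P"
            using f g by (auto simp: H_def T_def jb)
          ultimately show "f = g"
            by (meson PiE_ext)
        qed
        moreover have "(\<lambda>f. restrict f (S - {j})) ` H x \<subseteq> T (S - {j})"
          by (auto simp: H_def T_def jb PiE_iff split: if_splits)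
        moreover have "finite (T (S - {j}))"
          using finT S by blast
        ultimately have "card (H x) \<le> card (T (S - {j}))"
          by (rule card_inj_on_le)
        moreover have "p * card (T (S - {j})) \<le> 2 * card (T S)"
          using less.hyps[of "S - {j}" j] jb S finS card_Diff1_less[OF finS jb(2)]
          by (simp add: insert_absorb)
        ultimately show ?thesis
          by (meson mult_le_mono2 order_trans)
      qed
      have "T S \<subseteq> ext a \<union> (\<Union>x\<in>D. H x)"
        by (auto simp: ext_def D_def H_def T_def)
      then have "card (T S) \<le> card (ext a \<union> (\<Union>x\<in>D. H x))"
        by (rule card_mono[rotated]) (use finext finD finT[OF S(1)] in \<open>auto simp: H_def\<close>)
      also have "\<dots> \<le> card (ext a) + (\<Sum>x\<in>D. card (H x))"
        by (rule order_trans[OF card_Un_le add_left_mono[OF card_UN_le[OF finD]]])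
      finally have "p * card (T S) \<le> p * (card (ext a) + (\<Sum>x\<in>D. card (H x)))"
        by (rule mult_le_mono2)
      also have "\<dots> = p * card (ext a) + (\<Sum>x\<in>D. p * card (H x))"
        by (simp add: distrib_left sum_distrib_left)
      also have "(\<Sum>x\<in>D. p * card (H x)) \<le> card D * (2 * card (T S))"
        using H sum_bounded_above[of D "\<lambda>x. p * card (H x)" "2 * card (T S)"] by simp
      also have "\<dots> \<le> \<Delta> * (2 * card (T S))"
        using cardD by (rule mult_le_mono1)
      \<comment> \<open>Doubling lets \<open>4 * \<Delta> \<le> p\<close> turn the loss into
        \<open>p * card (T S)\<close>, half of the left-hand side.\<close>
      finally have "2 * (p * card (T S)) \<le> 2 * (p * card (ext a)) + (4 * \<Delta>) * card (T S)"
        by simp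
      also have "\<dots> \<le> 2 * (p * card (ext a)) + p * card (T S)"
        using assms(6) by (intro add_left_mono mult_le_mono1)
      finally have "p * card (T S) \<le> p * (2 * card (ext a))" by simp
      then show ?thesis using assms(7) by simp
    qed
    have "(\<lambda>(a, f). f(i := a)) ` Sigma (P i) ext \<subseteq> T (insert i S)"
    proof clarify
      fix a f assume a: "a \<in> P i" and f: "f \<in> ext a"
      have "f \<in> PiE S P" using f by (simp add: ext_def T_def)
      with a have "f(i := a) \<in> PiE (insert i S) P"
        by (rule PiE_fun_upd)
      moreover have "\<not> R (x, (f(i := a)) x) (y, (f(i := a)) y)"
        if xy: "x \<in> insert i S" "y \<in> insert i S" "x \<noteq> y" for x y
      proof -
        consider "x = i" "y \<in> S" | "y = i" "x \<in> S" | "x \<in> S" "y \<in> S"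
          using xy by blast
        then show ?thesis
        proof cases
          case 1
          then show ?thesis using f xy(3) by (simp add: ext_def)
        next
          case 2
          then have "\<not> R (i, a) (x, f x)" using f by (simp add: ext_def)
          then show ?thesis using 2 xy(3) sym by auto
        next
          case 3
          then have "x \<noteq> i" "y \<noteq> i" using less.prems(2) by auto
          then show ?thesis using 3 f xy(3) by (simp add: ext_def T_def)
        qed
      qed
      ultimately show "f(i := a) \<in> T (insert i S)"
        unfolding T_def by blast
    qed
    \<comment> \<open>Since \<open>i \<notin> S\<close>, every old function has the default value at
      \<open>i\<close>, so \<open>f(i := a)\<close> determines both \<open>a\<close> and
      \<open>f\<close>.\<close>
    moreover have "inj_on (\<lambda>(a, f). f(i := a)) (Sigma (P i) ext)"
    proof (rule inj_onI, clarify)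
      fix a f a' f' assume f: "f \<in> ext a" "f' \<in> ext a'" and eq: "f(i := a) = f'(i := a')"
      have "f \<in> PiE S P" "f' \<in> PiE S P" using f by (simp_all add: ext_def T_def)
      moreover have "f y = f' y" if "y \<in> S" for y
        using fun_cong[OF eq, of y] that less.prems(2) by (auto split: if_splits)
      ultimately show "a = a' \<and> f = f'"
        using fun_cong[OF eq, of i] by (auto intro: PiE_ext)
    qed
    ultimately have "card (Sigma (P i) ext) \<le> card (T (insert i S))"
      using finT[OF less.prems(1)] by (metis card_inj_on_le)
    moreover have "card (Sigma (P i) ext) = (\<Sum>a\<in>P i. card (ext a))"
      using finP[OF S(2)] finext by simp
    moreover have "card (P i) * card (T S) \<le> 2 * (\<Sum>a\<in>P i. card (ext a))"
      using half sum_bounded_below[of "P i" "card (T S)" "\<lambda>a. 2 * card (ext a)"]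
      by (simp add: sum_distrib_left)
    moreover have "p * card (T S) \<le> card (P i) * card (T S)"
      using cardP[OF S(2)] by (rule mult_le_mono1)
    ultimately show ?case by linarith
  qed
  have "0 < card (T S)" if "S \<subseteq> I" for S
  proof -
    have "finite S" using that assms(1) by (rule finite_subset)
    then show ?thesis using that
    proof (induction S)
      case empty
      then show ?case by (simp add: T_def)
    next
      case (insert i S)
      then show ?case using growth[of i S] assms(7)
        by (metis insert_subset mult_is_0 neq0_conv not_less zero_less_numeral)
    qed
  qed
  then obtain f where "f \<in> T I"
    by (metis card_gt_0_iff equals0I order_refl)
  then show ?thesis
    by (intro exI[of _ f]) (auto simp: T_def PiE_iff)
qed

subsection \<open>Two-coloured 4-cycles in regularly coloured graphs\<close>

locale edge_coloured_graph =
  fixes V :: "'a set" and E :: "'a set set" and d :: nat and h :: "'a set \<Rightarrow> nat"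
  assumes simple: "simple_graph V E"
    and regular: "regular V E d"
    and proper: "proper_edge_coloring E d h"
begin

lemma finite_V: "finite V" and finite_E: "finite E"
proof -
  show "finite V" using simple by (simp add: simple_graph_def)
  then show "finite E"
    using simple by (auto simp: simple_graph_def intro: finite_subset[of _ "Pow V"])
qed

lemma edge_subset: "e \<in> E \<Longrightarrow> e \<subseteq> V" and edge_card: "e \<in> E \<Longrightarrow> card e = 2"
  using simple by (auto simp: simple_graph_def)

lemma edge_finite: "e \<in> E \<Longrightarrow> finite e"
  using edge_card card.infinite by fastforce

lemma edge_other_end:
  assumes "e \<in> E" "v \<in> e"
  obtains w where "e = {v, w}" "w \<noteq> v"
proof -
  obtain x y where "e = {x, y}" "x \<noteq> y"
    using edge_card[OF assms(1)] by (auto simp: card_2_iff)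
  then show ?thesis using that[of x] that[of y] assms(2) by (auto simp: insert_commute)
qed

lemma colour_range: "e \<in> E \<Longrightarrow> h e \<in> {1..d}"
  using proper by (simp add: proper_edge_coloring_def)

lemma edge_eqI:
  "\<lbrakk>e \<in> E; f \<in> E; v \<in> e; v \<in> f; h e = h f\<rbrakk> \<Longrightarrow> e = f"
  using proper unfolding proper_edge_coloring_def properly_colored_def by blast

text \<open>Every colour class is a perfect matching; this map sends a vertex to its mate. It is
  meaningful only for \<open>v \<in> V\<close> and \<open>c \<in> {1..d}\<close>.\<close>

definition partner :: "nat \<Rightarrow> 'a \<Rightarrow> 'a" where
  "partner c v = (THE w. {v, w} \<in> E \<and> h {v, w} = c)"

lemma partner_eqI:
  assumes "{v, w} \<in> E" "h {v, w} = c"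
  shows "partner c v = w"
  unfolding partner_def
proof (rule the_equality)
  fix w' assume "{v, w'} \<in> E \<and> h {v, w'} = c"
  then have "{v, w'} = {v, w}"
    using edge_eqI[of "{v, w'}" "{v, w}" v] assms by auto
  then show "w' = w" by (auto simp: doubleton_eq_iff)
qed (use assms in auto)

text \<open>The \<open>d\<close> edges at \<open>v\<close> have distinct colours out of
  \<open>d\<close>, so every colour occurs there.\<close>

lemma partner_edge:
  assumes "v \<in> V" "c \<in> {1..d}"
  shows "{v, partner c v} \<in> E" "h {v, partner c v} = c"
proof -
  have "inj_on h (incident_edges E v)"
    by (rule inj_onI, rule edge_eqI[of _ _ v]) (auto simp: incident_edges_def)
  then have "card (h ` incident_edges E v) = card {1..d}"
    using regular assms by (simp add: regular_def card_image)
  moreover have "h ` incident_edges E v \<subseteq> {1..d}"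
    using colour_range by (auto simp: incident_edges_def)
  ultimately have "h ` incident_edges E v = {1..d}"
    using card_subset_eq[OF finite_atLeastAtMost] by blast
  then have "c \<in> h ` incident_edges E v"
    using assms(2) by (simp only:)
  then obtain e where e: "e \<in> E" "v \<in> e" "h e = c"
    by (auto simp: incident_edges_def)
  obtain w where w: "e = {v, w}" using edge_other_end[OF e(1,2)] by blast
  then have "partner c v = w" using e by (intro partner_eqI) auto
  then show "{v, partner c v} \<in> E" "h {v, partner c v} = c" using e w by auto
qed

lemma partner_partner: "\<lbrakk>v \<in> V; c \<in> {1..d}\<rbrakk> \<Longrightarrow> partner c (partner c v) = v"
  using partner_edge[of v c] by (intro partner_eqI) (auto simp: insert_commute)

lemma edge_eq_partner: "\<lbrakk>e \<in> E; v \<in> e\<rbrakk> \<Longrightarrow> e = {v, partner (h e) v}"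
  by (metis edge_other_end partner_eqI)

lemma partner_edge_inj:
  assumes "v \<in> V" shows "inj_on (\<lambda>c. {v, partner c v}) {1..d}"
  by (rule inj_onI) (metis assms partner_edge(2))

text \<open>A single linking edge is a path of length 1. Thus opposite edges of a square lie in each
  other's neighbourhood, and the sparsity along matchings applies to them.\<close>

lemma edge_nbhdI:
  assumes "f \<in> E" "e \<in> E" "{x, y} \<in> E" "x \<in> f" "y \<in> e"
  shows "e \<in> edge_nbhd E 6 f"
proof -
  have "x \<noteq> y" using edge_card[OF assms(3)] by auto
  then have "is_path E [x, y]"
    using assms(3) by (auto simp: is_path_def nth_Cons split: nat.splits)
  then have "edge_dist E f e \<le> enat (length [x, y] - 1)"
    unfolding edge_dist_def using assms by (intro INF_lower) auto
  also have "\<dots> \<le> enat 6" by simp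
  finally show ?thesis using assms by (simp add: edge_nbhd_def)
qed

text \<open>For \<open>c \<in> switchable e\<close> the edges of \<open>square e c\<close> form the 4-cycle through \<open>e\<close> that is
  coloured with \<open>h e\<close> and \<open>c\<close>.\<close>

definition switchable :: "'a set \<Rightarrow> nat set" where
  "switchable e = {c \<in> {1..d}. c \<noteq> h e \<and> partner c ` e \<in> E \<and> h (partner c ` e) = h e}"

definition square :: "'a set \<Rightarrow> nat \<Rightarrow> 'a set set" where
  "square e c = {e, partner c ` e} \<union> (\<lambda>w. {w, partner c w}) ` e"

lemma square_edge:
  assumes "e \<in> E" "c \<in> switchable e" "f \<in> square e c"
  shows "f \<in> E" "f = e \<or> f = partner c ` e \<Longrightarrow> h f = h e"
    "f \<noteq> e \<Longrightarrow> f \<noteq> partner c ` e \<Longrightarrow> h f = c"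
  using assms edge_subset[OF assms(1)] partner_edge[of _ c]
  by (auto simp: square_def switchable_def)

text \<open>\<open>transpose (h e) c (h f)\<close> is the colour of \<open>f\<close> after the
  interchange. The edge at \<open>v\<close> that had this colour before is on the same square, so
  the interchange creates no clash with edges off the square.\<close>

lemma square_closed:
  assumes e: "e \<in> E" and c: "c \<in> switchable e" and f: "f \<in> square e c" and v: "v \<in> f"
  shows "{v, partner (transpose (h e) c (h f)) v} \<in> square e c"
proof -
  have c': "c \<in> {1..d}" "c \<noteq> h e" "partner c ` e \<in> E" "h (partner c ` e) = h e"
    using c by (auto simp: switchable_def)
  have side: "h {w, partner c w} = c" "partner c (partner c w) = w" if "w \<in> e" for w
    using that edge_subset[OF e] c' partner_edge[of w c] partner_partner[of w c] by auto
  from f consider "f = e" | "f = partner c ` e" | w where "w \<in> e" "f = {w, partner c w}"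
    by (auto simp: square_def)
  then show ?thesis
  proof cases
    case 1
    then show ?thesis using v by (auto simp: square_def)
  next
    case 2
    then obtain w where w: "w \<in> e" "v = partner c w" using v by auto
    have "{v, partner c v} = {w, partner c w}"
      using side(2)[OF w(1)] w(2) by (auto simp: insert_commute)
    then show ?thesis using 2 c' w by (auto simp: square_def)
  next
    case (3 w)
    then consider "v = w" | "v = partner c w" using v by auto
    then show ?thesis
    proof cases
      case 1
      then show ?thesis
        using 3 side(1)[of w] edge_eq_partner[OF e, of w] by (auto simp: square_def)
    next
      case 2
      have "partner c ` e = {v, partner (h e) v}"
        using edge_eq_partner[OF c'(3), of v] c'(4) 2 3 by auto
      then show ?thesis using 3 side(1)[of w] by (auto simp: square_def)
    qed
  qed
qed

lemma two_coloured_four_cycle: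
  assumes e: "e \<in> E" and C: "is_cycle E 4 C" "two_colored h C" "e \<in> C"
  shows "\<exists>c\<in>switchable e. C = square e c"
proof -
  \<comment> \<open>Normal form: the cycle is listed from \<open>e = {p, q}\<close> on, and the
    witness is the colour of \<open>{q, r}\<close>.\<close>
  have cyc: "\<exists>c\<in>switchable {p, q}. {{p, q}, {q, r}, {r, t}, {t, p}} = square {p, q} c"
    if dist: "distinct [p, q, r, t]"
      and sub: "{{p, q}, {q, r}, {r, t}, {t, p}} \<subseteq> E"
      and two: "two_colored h {{p, q}, {q, r}, {r, t}, {t, p}}" for p q r t
  proof -
    have edges: "{p, q} \<in> E" "{q, r} \<in> E" "{r, t} \<in> E" "{t, p} \<in> E" using sub by auto
    have ne: "h {p, q} \<noteq> h {q, r}" "h {q, r} \<noteq> h {r, t}" "h {r, t} \<noteq> h {t, p}" "h {t, p} \<noteq> h {p, q}"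
      using edge_eqI[of "{p, q}" "{q, r}" q] edge_eqI[of "{q, r}" "{r, t}" r]
        edge_eqI[of "{r, t}" "{t, p}" t] edge_eqI[of "{t, p}" "{p, q}" p] edges dist
      by (auto simp: doubleton_eq_iff)
    have "card {h {p, q}, h {q, r}, h {r, t}, h {t, p}} = 2"
      using two by (simp add: two_colored_def)
    \<comment> \<open>Consecutive edges differ and only two colours occur, so opposite edges
      agree.\<close>
    then have opp: "h {r, t} = h {p, q}" "h {t, p} = h {q, r}"
      using ne by (auto simp: card_insert_if split: if_splits)
    let ?c = "h {q, r}"
    have part: "partner ?c q = r" "partner ?c p = t"
      using edges opp by (auto intro!: partner_eqI simp: insert_commute)
    have img: "partner ?c ` {p, q} = {r, t}" using part by auto
    have "?c \<in> switchable {p, q}"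
      using edges opp ne colour_range[OF edges(2)]
      by (auto simp: switchable_def part insert_commute)
    moreover have "{{p, q}, {q, r}, {r, t}, {t, p}} = square {p, q} ?c"
      unfolding square_def img using part by (auto simp: insert_commute)
    ultimately show ?thesis by blast
  qed
  obtain xs where xs: "length xs = 4" "distinct xs" "C = {{xs ! i, xs ! (Suc i mod 4)} |i. i < 4}"
    and sub: "C \<subseteq> E"
    using C(1) by (auto simp: is_cycle_def)
  obtain x0 x1 x2 x3 where x: "xs = [x0, x1, x2, x3]"
    using xs(1) by (auto simp: numeral_eq_Suc length_Suc_conv)
  have "{i::nat. i < 4} = {0, 1, 2, 3}" by auto
  then have "C = (\<lambda>i. {xs ! i, xs ! (Suc i mod 4)}) ` {0, 1, 2, 3}"
    unfolding xs(3) by (simp add: setcompr_eq_image)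
  then have Ceq: "C = {{x0, x1}, {x1, x2}, {x2, x3}, {x3, x0}}"
    by (simp add: x)
  \<comment> \<open>Rotating the list brings every possible position of \<open>e\<close> to the
    front.\<close>
  then have rot: "C = {{x1, x2}, {x2, x3}, {x3, x0}, {x0, x1}}"
    "C = {{x2, x3}, {x3, x0}, {x0, x1}, {x1, x2}}" "C = {{x3, x0}, {x0, x1}, {x1, x2}, {x2, x3}}"
    by auto
  from C(3) consider "e = {x0, x1}" | "e = {x1, x2}" | "e = {x2, x3}" | "e = {x3, x0}"
    unfolding Ceq by auto
  then show ?thesis
  proof cases
    case 1
    show ?thesis using cyc[of x0 x1 x2 x3] sub C(2) xs(2) unfolding 1 Ceq x by simp
  next
    case 2
    show ?thesis using cyc[of x1 x2 x3 x0] sub C(2) xs(2) unfolding 2 rot(1) x by auto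
  next
    case 3
    show ?thesis using cyc[of x2 x3 x0 x1] sub C(2) xs(2) unfolding 3 rot(2) x by auto
  next
    case 4
    show ?thesis using cyc[of x3 x0 x1 x2] sub C(2) xs(2) unfolding 4 rot(3) x by auto
  qed
qed

lemma finite_switchable: "finite (switchable e)"
  by (simp add: switchable_def)

text \<open>\<open>square e\<close> maps the switchable colours onto a family containing all
  two-coloured 4-cycles through \<open>e\<close>, so there are at least as many colours as
  cycles.\<close>

lemma card_switchable:
  assumes "standard_coloring E d s h" "e \<in> E"
  shows "s - 1 \<le> card (switchable e)"
proof -
  have "{C. is_cycle E 4 C \<and> two_colored h C \<and> e \<in> C} \<subseteq> square e ` switchable e"
    using two_coloured_four_cycle[OF assms(2)] by blast
  then have "card {C. is_cycle E 4 C \<and> two_colored h C \<and> e \<in> C} \<le> card (switchable e)"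
    using finite_switchable by (rule surj_card_le[rotated])
  then show ?thesis
    using assms unfolding standard_coloring_def by (meson order_trans)
qed

text \<open>The factor 2 cannot be dropped: in a \<open>K\<^sub>4\<close>, two different colours \<open>c\<close> give the same opposite
  edge.\<close>

lemma card_opposite_edge_le:
  assumes f: "f \<in> E" and X: "finite X" "\<And>e c. (e, c) \<in> X \<Longrightarrow> e \<in> E \<and> c \<in> switchable e \<and> partner c ` e = f"
    and b: "card {e \<in> E. h e = h f \<and> e \<in> edge_nbhd E 6 f \<and> Q e} \<le> b"
    and Q: "\<And>e c. (e, c) \<in> X \<Longrightarrow> Q e"
  shows "card X \<le> 2 * b"
proof -
  obtain w where w: "w \<in> f" using edge_card[OF f] by fastforce
  define N where "N = {e \<in> E. h e = h f \<and> e \<in> edge_nbhd E 6 f \<and> Q e}"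
  have finN: "finite N" using finite_E by (simp add: N_def)
  \<comment> \<open>For a fixed end \<open>w\<close> of \<open>f\<close>, the end \<open>x\<close>
    of \<open>e\<close> mated to \<open>w\<close> determines \<open>c\<close> as the colour of
    \<open>{w, x}\<close>; each \<open>e\<close> has two candidates for \<open>x\<close>.\<close>
  have "X \<subseteq> (\<lambda>(e, x). (e, h {w, x})) ` Sigma N (\<lambda>e. e)"
  proof clarify
    fix e c assume ec: "(e, c) \<in> X"
    then have e: "e \<in> E" "c \<in> switchable e" "partner c ` e = f" using X by auto
    obtain x where x: "x \<in> e" "w = partner c x" using w e(3) by auto
    have "x \<in> V" "c \<in> {1..d}" using x e edge_subset by (auto simp: switchable_def)
    then have wx: "{w, x} \<in> E" "h {w, x} = c"
      using partner_edge[of x c] x(2) by (auto simp: insert_commute)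
    have "e \<in> N"
      using edge_nbhdI[OF f e(1) wx(1) w x(1)] e Q[OF ec] by (auto simp: N_def switchable_def)
    then show "(e, c) \<in> (\<lambda>(e, x). (e, h {w, x})) ` Sigma N (\<lambda>e. e)"
      using x(1) wx(2) by force
  qed
  moreover have "finite (Sigma N (\<lambda>e. e))"
    using finN edge_finite by (auto simp: N_def)
  ultimately have "card X \<le> card (Sigma N (\<lambda>e. e))"
    by (rule surj_card_le[rotated])
  also have "\<dots> = (\<Sum>e\<in>N. card e)"
    using finN edge_finite by (intro card_SigmaI) (auto simp: N_def)
  also have "\<dots> = 2 * card N"
    using edge_card by (simp add: N_def)
  finally show ?thesis using b by (simp add: N_def)
qed

subsection \<open>Repairing the conflicts\<close>

text \<open>The deterministic half of the argument. At most \<open>3 * k + 5 * b\<close> switchable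
  colours of an edge are unusable, so \<open>27 * k + 29 * b < s\<close> leaves
  \<open>24 * (k + b)\<close>, four times the bound \<open>6 * (k + b)\<close> on the clashes of one
  square.\<close>

lemma ex_repaired_colouring:
  fixes L :: "'a set \<Rightarrow> nat set"
  assumes \<rho>: "\<rho> permutes {1..d}"
    and L: "\<And>e. e \<in> E \<Longrightarrow> L e \<subseteq> {1..d} \<and> card (L e) \<le> b"
    and L_vertex: "\<And>v c. v \<in> V \<Longrightarrow> c \<in> {1..d} \<Longrightarrow> card {e \<in> incident_edges E v. c \<in> L e} \<le> b"
    and L_matching: "\<And>f c. f \<in> E \<Longrightarrow> c \<in> {1..d} \<Longrightarrow>
       card {e \<in> E. h e = h f \<and> e \<in> edge_nbhd E 6 f \<and> c \<in> L e} \<le> b"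
    and hits_vertex: "\<And>v. v \<in> V \<Longrightarrow> card {c \<in> {1..d}. \<rho> c \<in> L {v, partner c v}} \<le> k"
    and hits_edge: "\<And>e. e \<in> E \<Longrightarrow> card {c \<in> switchable e. \<rho> c \<in> L (partner c ` e)} \<le> k"
    and many: "\<And>e. e \<in> E \<Longrightarrow> s - 1 \<le> card (switchable e)"
    and "27 * k + 29 * b < s" "0 < k"
  shows "\<exists>\<phi>. proper_edge_coloring E d \<phi> \<and> avoids E \<phi> L"
proof -
  define Conf where "Conf = {e \<in> E. \<rho> (h e) \<in> L e}"
  have Conf_E: "Conf \<subseteq> E" and finConf: "finite Conf"
    using finite_E by (auto simp: Conf_def)
  have \<rho>_range: "\<rho> c \<in> {1..d}" if "c \<in> {1..d}" for c
    using permutes_in_image[OF \<rho>] that by blast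
  have \<rho>_inj: "inj_on \<rho> A" for A
    using permutes_inj[OF \<rho>] by (rule inj_on_subset) simp
  have conf_matching: "card {e \<in> E. h e = h f \<and> e \<in> edge_nbhd E 6 f \<and> e \<in> Conf} \<le> b" if f: "f \<in> E" for f
  proof -
    have "{e \<in> E. h e = h f \<and> e \<in> edge_nbhd E 6 f \<and> e \<in> Conf}
        = {e \<in> E. h e = h f \<and> e \<in> edge_nbhd E 6 f \<and> \<rho> (h f) \<in> L e}"
      by (auto simp: Conf_def)
    then show ?thesis
      using L_matching[OF f \<rho>_range[OF colour_range[OF f]]] by simp
  qed
  have conf_vertex: "card {c \<in> {1..d}. {v, partner c v} \<in> Conf} \<le> k" if v: "v \<in> V" for v
  proof -
    have "{c \<in> {1..d}. {v, partner c v} \<in> Conf} \<subseteq> {c \<in> {1..d}. \<rho> c \<in> L {v, partner c v}}"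
      using partner_edge(2)[OF v] by (auto simp: Conf_def)
    then show ?thesis
      by (intro order_trans[OF card_mono hits_vertex[OF v]]) simp
  qed
  \<comment> \<open>The interchange puts \<open>\<rho> c\<close> on \<open>e\<close> and its
    opposite edge and \<open>\<rho> (h e)\<close> on the two sides. These colours must be allowed
    there, and no edge of the square other than \<open>e\<close> may be conflicting
    beforehand.\<close>
  define safe where "safe e = {c \<in> switchable e. \<rho> c \<notin> L e \<and> \<rho> c \<notin> L (partner c ` e)
      \<and> partner c ` e \<notin> Conf
      \<and> (\<forall>w\<in>e. \<rho> (h e) \<notin> L {w, partner c w} \<and> {w, partner c w} \<notin> Conf)}" for e
  have finsafe: "finite (safe e)" for e
    using finite_switchable by (simp add: safe_def)

  \<comment> \<open>Many safe squares at every edge\<close>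
  have card_safe: "24 * (k + b) \<le> card (safe e)" if e: "e \<in> E" for e
  proof -
    obtain u v where uv: "e = {u, v}"
      using edge_card[OF e] by (auto simp: card_2_iff)
    have uvV: "u \<in> V" "v \<in> V" using edge_subset[OF e] uv by auto
    \<comment> \<open>The five kinds of obstruction to safety cost \<open>b\<close> for
      \<open>X1\<close>, \<open>k\<close> for \<open>X2\<close>, \<open>2 * b\<close> for
      \<open>X3\<close>, and \<open>b\<close> for \<open>Y\<close> and \<open>k\<close> for
      \<open>Z\<close> at each of the two ends.\<close>
    define X1 where "X1 = {c \<in> {1..d}. \<rho> c \<in> L e}"
    define X2 where "X2 = {c \<in> switchable e. \<rho> c \<in> L (partner c ` e)}"
    define X3 where "X3 = {c \<in> switchable e. partner c ` e \<in> Conf}"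
    define Y where "Y w = {c \<in> {1..d}. \<rho> (h e) \<in> L {w, partner c w}}" for w
    define Z where "Z w = {c \<in> {1..d}. {w, partner c w} \<in> Conf}" for w
    have "card X1 \<le> card (L e)"
      by (rule card_inj_on_le[of \<rho>]) (use \<rho>_inj L[OF e] in \<open>auto simp: X1_def intro: finite_subset\<close>)
    then have X1: "card X1 \<le> b" using L[OF e] by simp
    have X2: "card X2 \<le> k" using hits_edge[OF e] by (simp add: X2_def)
    have X3: "card X3 \<le> 2 * b"
    proof -
      define N where "N = {f \<in> E. h f = h e \<and> f \<in> edge_nbhd E 6 e \<and> f \<in> Conf}"
      have finN: "finite N" using finite_E by (simp add: N_def)
      \<comment> \<open>Here \<open>e\<close> is fixed and the opposite edge \<open>f\<close>
        varies: \<open>c\<close> is the colour of the edge from \<open>u\<close> to an end of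
        \<open>f\<close>, so each \<open>f\<close> arises from at most two colours.\<close>
      have "X3 \<subseteq> (\<lambda>(f, x). h {u, x}) ` Sigma N (\<lambda>f. f)"
      proof
        fix c assume c: "c \<in> X3"
        let ?f = "partner c ` e"
        have c': "?f \<in> E" "h ?f = h e" "c \<in> {1..d}" "?f \<in> Conf"
          using c by (auto simp: X3_def switchable_def)
        have "?f \<in> edge_nbhd E 6 e"
          using edge_nbhdI[OF e c'(1) partner_edge(1)[OF uvV(1) c'(3)]] uv by auto
        then have "(?f, partner c u) \<in> Sigma N (\<lambda>f. f)" using c' uv by (auto simp: N_def)
        then show "c \<in> (\<lambda>(f, x). h {u, x}) ` Sigma N (\<lambda>f. f)"
          using partner_edge(2)[OF uvV(1) c'(3)] by force
      qed
      moreover have "finite (Sigma N (\<lambda>f. f))"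
        using finN edge_finite by (auto simp: N_def)
      ultimately have "card X3 \<le> card (Sigma N (\<lambda>f. f))"
        by (rule surj_card_le[rotated])
      also have "\<dots> = (\<Sum>f\<in>N. card f)"
        using finN edge_finite by (intro card_SigmaI) (auto simp: N_def)
      also have "\<dots> = 2 * card N"
        using edge_card by (simp add: N_def)
      finally show ?thesis using conf_matching[OF e] by (simp add: N_def)
    qed
    have Y: "card (Y w) \<le> b" if w: "w \<in> V" for w
    proof -
      have "inj_on (\<lambda>c. {w, partner c w}) (Y w)"
        using partner_edge_inj[OF w] by (rule inj_on_subset) (auto simp: Y_def)
      moreover have "(\<lambda>c. {w, partner c w}) ` Y w \<subseteq> {f \<in> incident_edges E w. \<rho> (h e) \<in> L f}"
        using partner_edge[OF w] by (auto simp: Y_def incident_edges_def)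
      moreover have "finite {f \<in> incident_edges E w. \<rho> (h e) \<in> L f}"
        using finite_E by (simp add: incident_edges_def)
      ultimately have "card (Y w) \<le> card {f \<in> incident_edges E w. \<rho> (h e) \<in> L f}"
        by (rule card_inj_on_le)
      then show ?thesis
        using L_vertex[OF w \<rho>_range[OF colour_range[OF e]]] by simp
    qed
    have Z: "card (Z w) \<le> k" if "w \<in> V" for w
      using conf_vertex[OF that] by (simp add: Z_def)
    have cover: "card (switchable e)
        \<le> card (safe e) + (card X1 + (card X2 + (card X3 + ((card (Y u) + card (Z u)) + (card (Y v) + card (Z v))))))"
    proof -
      let ?U = "safe e \<union> (X1 \<union> (X2 \<union> (X3 \<union> ((Y u \<union> Z u) \<union> (Y v \<union> Z v)))))"
      have "switchable e \<subseteq> ?U"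
        by (auto simp: safe_def X1_def X2_def X3_def Y_def Z_def uv switchable_def)
      moreover have "finite ?U"
        using finsafe finite_switchable by (auto simp: X1_def X2_def X3_def Y_def Z_def)
      ultimately have "card (switchable e) \<le> card ?U" by (rule card_mono[rotated])
      also have "\<dots> \<le> card (safe e) + (card X1 + (card X2 + (card X3 + ((card (Y u) + card (Z u)) + (card (Y v) + card (Z v))))))"
        by (intro order_trans[OF card_Un_le] add_mono order_refl)
      finally show ?thesis .
    qed
    have "27 * k + 29 * b \<le> card (switchable e)"
      using many[OF e] assms(8) by linarith
    then show ?thesis
      using cover X1 X2 X3 Y[OF uvV(1)] Y[OF uvV(2)] Z[OF uvV(1)] Z[OF uvV(2)] by presburger
  qed

  \<comment> \<open>Safe squares through a conflict-free edge\<close>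
  have few_squares: "card {(j, c). j \<in> Conf \<and> c \<in> safe j \<and> f \<in> square j c} \<le> 2 * k + 2 * b"
    if f: "f \<in> E" "f \<notin> Conf" for f
  proof -
    obtain u v where uv: "f = {u, v}"
      using edge_card[OF f(1)] by (auto simp: card_2_iff)
    have uvV: "u \<in> V" "v \<in> V" using edge_subset[OF f(1)] uv by auto
    \<comment> \<open>If \<open>f\<close> is not opposite to \<open>j\<close>, it is a side of the
      square: then \<open>c = h f\<close> and the conflicting edge \<open>j\<close> meets
      \<open>f\<close> in \<open>u\<close> or \<open>v\<close>. \<open>W w\<close> collects the
      pairs possible at \<open>w\<close>.\<close>
    define W where "W w = (\<lambda>c. ({w, partner c w}, h f)) ` {c \<in> {1..d}. {w, partner c w} \<in> Conf}" for w
    define X where "X = {(j, c). j \<in> Conf \<and> c \<in> safe j \<and> partner c ` j = f}"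
    have "X \<subseteq> Sigma Conf safe" by (auto simp: X_def)
    then have finX: "finite X"
      by (rule finite_subset) (use finConf finsafe in auto)
    have cardX: "card X \<le> 2 * b"
      by (rule card_opposite_edge_le[OF f(1) finX _ conf_matching[OF f(1)]])
        (use Conf_E in \<open>auto simp: X_def safe_def\<close>)
    have cardW: "card (W w) \<le> k" if "w \<in> V" for w
      unfolding W_def by (rule order_trans[OF card_image_le conf_vertex[OF that]]) simp
    have "{(j, c). j \<in> Conf \<and> c \<in> safe j \<and> f \<in> square j c} \<subseteq> X \<union> (W u \<union> W v)"
    proof (rule subsetI, rule UnCI)
      fix y assume "y \<in> {(j, c). j \<in> Conf \<and> c \<in> safe j \<and> f \<in> square j c}" "y \<notin> W u \<union> W v"
      then obtain j c where y: "y = (j, c)"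
        and j: "j \<in> Conf" "c \<in> safe j" "f \<in> square j c" "(j, c) \<notin> W u \<union> W v" by auto
      have jE: "j \<in> E" using j Conf_E by auto
      have c: "c \<in> switchable j" using j by (simp add: safe_def)
      have "f \<noteq> j" using j f by auto
      show "y \<in> X"
      proof (rule ccontr)
        assume "y \<notin> X"
        then have "f \<noteq> partner c ` j" using j y by (auto simp: X_def)
        then have hf: "h f = c" using square_edge(3)[OF jE c j(3)] \<open>f \<noteq> j\<close> by simp
        obtain w where w: "w \<in> j" "f = {w, partner c w}"
          using j(3) \<open>f \<noteq> j\<close> \<open>f \<noteq> partner c ` j\<close> by (auto simp: square_def)
        have "(j, c) \<in> W w"
          unfolding W_def using edge_eq_partner[OF jE w(1)] hf colour_range[OF jE] j(1)
          by (intro image_eqI[of _ _ "h j"]) auto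
        moreover have "w = u \<or> w = v" using w(2) uv by auto
        ultimately show False using j(4) by auto
      qed
    qed
    moreover have "finite (X \<union> (W u \<union> W v))" using finX by (simp add: W_def)
    ultimately have "card {(j, c). j \<in> Conf \<and> c \<in> safe j \<and> f \<in> square j c} \<le> card (X \<union> (W u \<union> W v))"
      by (rule card_mono[rotated])
    also have "\<dots> \<le> card X + (card (W u) + card (W v))"
      by (intro order_trans[OF card_Un_le] add_mono order_refl)
    finally show ?thesis using cardX cardW[OF uvV(1)] cardW[OF uvV(2)] by linarith
  qed

  \<comment> \<open>Choice of edge-disjoint squares\<close>
  define R where "R = (\<lambda>(e, c) (e', c'). square e c \<inter> square e' c' \<noteq> ({} :: 'a set set))"
  \<comment> \<open>A safe square has three edges besides \<open>e\<close>, each on at most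
    \<open>2 * k + 2 * b\<close> safe squares of conflicting edges; this gives the value of
    \<open>\<Delta>\<close>.\<close>
  have "\<exists>F. \<forall>e\<in>Conf. F e \<in> safe e \<and> (\<forall>e'\<in>Conf. e \<noteq> e' \<longrightarrow> \<not> R (e, F e) (e', F e'))"
  proof (rule ex_independent_transversal[where p = "24 * (k + b)" and \<Delta> = "6 * (k + b)"])
    fix e c assume e: "e \<in> Conf" and c: "c \<in> safe e"
    define B where "B f = {(j, c'). j \<in> Conf \<and> c' \<in> safe j \<and> f \<in> square j c'}" for f
    have "B f \<subseteq> Sigma Conf safe" for f by (auto simp: B_def)
    then have finB: "finite (B f)" for f
      by (rule finite_subset) (use finConf finsafe in auto)
    have eE: "e \<in> E" using e Conf_E by auto
    have c_sw: "c \<in> switchable e" using c by (simp add: safe_def)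
    obtain u v where uv: "e = {u, v}"
      using edge_card[OF eE] by (auto simp: card_2_iff)
    have not_conf: "f \<notin> Conf" if "f \<in> square e c" "f \<noteq> e" for f
      using c that by (auto simp: safe_def square_def)
    have cardB: "card (B f) \<le> 2 * k + 2 * b" if "f \<in> square e c" "f \<noteq> e" for f
      unfolding B_def using few_squares[OF square_edge(1)[OF eE c_sw that(1)] not_conf[OF that]] .
    let ?f = "partner c ` e" and ?g = "{u, partner c u}" and ?k = "{v, partner c v}"
    have in_square: "square e c = {e, ?f, ?g, ?k}" by (auto simp: square_def uv)
    have ne: "?f \<noteq> e" "?g \<noteq> e" "?k \<noteq> e"
    proof -
      have "c \<noteq> h e" "c \<in> {1..d}" "u \<in> V" "v \<in> V"
        using c_sw edge_subset[OF eE] uv by (auto simp: switchable_def)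
      then show "?g \<noteq> e" "?k \<noteq> e"
        using partner_edge(2)[of u c] partner_edge(2)[of v c] by auto
      show "?f \<noteq> e"
      proof
        assume "?f = e"
        then have "partner c u = u \<or> partner c u = v" using uv by auto
        moreover have "partner c u \<noteq> u"
          using partner_edge(1)[OF \<open>u \<in> V\<close> \<open>c \<in> {1..d}\<close>] edge_card by fastforce
        ultimately show False using \<open>?g \<noteq> e\<close> uv by auto
      qed
    qed
    have "{(j, c'). j \<in> Conf - {e} \<and> c' \<in> safe j \<and> R (e, c) (j, c')} \<subseteq> B ?f \<union> (B ?g \<union> B ?k)"
    proof (rule subsetI, rule UnCI)
      fix y assume "y \<in> {(j, c'). j \<in> Conf - {e} \<and> c' \<in> safe j \<and> R (e, c) (j, c')}" "y \<notin> B ?g \<union> B ?k"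
      then obtain j c' where y: "y = (j, c')"
        and j: "j \<in> Conf" "j \<noteq> e" "c' \<in> safe j" "R (e, c) (j, c')"
        and notin: "(j, c') \<notin> B ?g" "(j, c') \<notin> B ?k" by auto
      obtain f where f: "f \<in> square e c" "f \<in> square j c'" using j(4) by (auto simp: R_def)
      \<comment> \<open>The edge \<open>e\<close> is conflicting, whereas a safe square of
        \<open>j\<close> contains no conflicting edge other than \<open>j\<close>.\<close>
      have "f \<noteq> e"
      proof
        assume "f = e"
        then have "f \<notin> Conf"
          using j f(2) by (auto simp: safe_def square_def)
        then show False using e \<open>f = e\<close> by simp
      qed
      then show "y \<in> B ?f"
        using f j y notin unfolding in_square B_def by auto
    qed
    moreover have "finite (B ?f \<union> (B ?g \<union> B ?k))" using finB by simp
    ultimately have "card {(j, c'). j \<in> Conf - {e} \<and> c' \<in> safe j \<and> R (e, c) (j, c')}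
        \<le> card (B ?f \<union> (B ?g \<union> B ?k))"
      by (rule card_mono[rotated])
    also have "\<dots> \<le> card (B ?f) + (card (B ?g) + card (B ?k))"
      by (intro order_trans[OF card_Un_le] add_mono order_refl)
    also have "\<dots> \<le> 6 * (k + b)"
      using cardB[of ?f] cardB[of ?g] cardB[of ?k] ne unfolding in_square by simp
    finally show "card {(j, c'). j \<in> Conf - {e} \<and> c' \<in> safe j \<and> R (e, c) (j, c')} \<le> 6 * (k + b)" .
  qed (use finConf finsafe card_safe Conf_E assms(9) in \<open>auto simp: R_def\<close>)
  then obtain F where F: "\<And>e. e \<in> Conf \<Longrightarrow> F e \<in> safe e"
    and disj: "\<And>e e'. \<lbrakk>e \<in> Conf; e' \<in> Conf; e \<noteq> e'\<rbrakk> \<Longrightarrow> square e (F e) \<inter> square e' (F e') = {}"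
    by (auto simp: R_def)

  \<comment> \<open>The repaired colouring\<close>
  have F_sw: "F e \<in> switchable e" if "e \<in> Conf" for e
    using F[OF that] by (simp add: safe_def)
  \<comment> \<open>Disjointness of the squares makes the choice by \<open>SOME\<close> unambiguous.
    \<open>g\<close> still uses the names of the old colours; the final colouring applies
    \<open>\<rho>\<close> afterwards.\<close>
  define g where "g f = (if \<exists>e\<in>Conf. f \<in> square e (F e)
      then (let e = SOME e. e \<in> Conf \<and> f \<in> square e (F e) in transpose (h e) (F e) (h f))
      else h f)" for f
  have g_in: "g f = transpose (h e) (F e) (h f)" if "e \<in> Conf" "f \<in> square e (F e)" for e f
  proof -
    have "(SOME e. e \<in> Conf \<and> f \<in> square e (F e)) = e"
      by (rule some_equality) (use that disj in blast)+
    then show ?thesis using that by (auto simp: g_def Let_def)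
  qed
  have g_out: "g f = h f" if "\<not> (\<exists>e\<in>Conf. f \<in> square e (F e))" for f
    using that by (simp add: g_def)
  have g_range: "g f \<in> {1..d}" if "f \<in> E" for f
  proof (cases "\<exists>e\<in>Conf. f \<in> square e (F e)")
    case True
    then obtain e where e: "e \<in> Conf" "f \<in> square e (F e)" by blast
    have "h e \<in> {1..d}" "F e \<in> {1..d}" "h f \<in> {1..d}"
      using e F_sw[OF e(1)] Conf_E colour_range that by (auto simp: switchable_def)
    then show ?thesis using g_in[OF e] by (auto simp: transpose_def)
  qed (use g_out colour_range[OF that] in simp)
  \<comment> \<open>Key to properness: the new colour \<open>g f\<close> and the end
    \<open>v\<close> determine the old colour \<open>h f\<close>, so two edges at \<open>v\<close>
    with equal new colours had equal old ones.\<close>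
  have g_swap: "g {v, partner (g f) v} = h f" if f: "f \<in> E" "v \<in> f" for f v
  proof (cases "\<exists>e\<in>Conf. f \<in> square e (F e)")
    case True
    then obtain e where e: "e \<in> Conf" "f \<in> square e (F e)" by blast
    have eE: "e \<in> E" using e Conf_E by auto
    have "v \<in> V" using f edge_subset by auto
    then have "h {v, partner (g f) v} = g f"
      using partner_edge(2) g_range[OF f(1)] by blast
    moreover have "{v, partner (g f) v} \<in> square e (F e)"
      using square_closed[OF eE F_sw[OF e(1)] e(2) f(2)] g_in[OF e] by simp
    ultimately show ?thesis
      using g_in[OF e] g_in[OF e(1)] by simp
  next
    case False
    then show ?thesis
      using g_out[OF False] edge_eq_partner[OF f] by simp
  qed
  have "properly_colored E (\<lambda>f. \<rho> (g f))"
    unfolding properly_colored_def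
  proof (intro ballI impI notI)
    fix f f' assume f: "f \<in> E" "f' \<in> E" "f \<noteq> f'" "f \<inter> f' \<noteq> {}" "\<rho> (g f) = \<rho> (g f')"
    then obtain v where v: "v \<in> f" "v \<in> f'" by blast
    have "g f = g f'" using f(5) permutes_inj[OF \<rho>] by (simp add: inj_eq)
    then have "h f = h f'"
      using g_swap[OF f(1) v(1)] g_swap[OF f(2) v(2)] by simp
    then show False using edge_eqI[OF f(1,2) v] f(3) by simp
  qed
  then have "proper_edge_coloring E d (\<lambda>f. \<rho> (g f))"
    using \<rho>_range g_range by (simp add: proper_edge_coloring_def)
  moreover have "avoids E (\<lambda>f. \<rho> (g f)) L"
    unfolding avoids_def
  proof
    fix f assume f: "f \<in> E"
    show "\<rho> (g f) \<notin> L f"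
    proof (cases "\<exists>e\<in>Conf. f \<in> square e (F e)")
      case True
      then obtain e where e: "e \<in> Conf" "f \<in> square e (F e)" by blast
      have eE: "e \<in> E" using e Conf_E by auto
      note se = square_edge[OF eE F_sw[OF e(1)] e(2)]
      show ?thesis
      proof (cases "f = e \<or> f = partner (F e) ` e")
        case True
        then have "g f = F e" using g_in[OF e] se(2) by simp
        then show ?thesis using True F[OF e(1)] by (auto simp: safe_def)
      next
        case False
        then have "g f = h e" using g_in[OF e] se(3) by simp
        then show ?thesis using False e F[OF e(1)] by (auto simp: safe_def square_def)
      qed
    next
      case False
      \<comment> \<open>Each conflicting edge lies on its own chosen square.\<close>
      have "f \<notin> Conf" using False by (auto simp: square_def)
      then show ?thesis using g_out[OF False] f by (simp add: Conf_def)
    qed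
  qed
  ultimately show ?thesis by blast
qed

end

subsection \<open>Choice of the parameters\<close>

text \<open>\<open>k ^ k / fact k\<close> is a single term of the series of
  \<open>exp k\<close>.\<close>

lemma power_self_le_exp_fact: "real k ^ k \<le> exp (real k) * fact k"
proof -
  have "real k ^ k / fact k \<le> (\<Sum>i\<le>k. real k ^ i / fact i)"
    by (rule member_le_sum) auto
  also have "\<dots> \<le> exp (real k)"
    unfolding exp_def
    using sum_le_suminf[OF summable_exp[of "real k"], of "{..k}"]
    by (simp add: divide_inverse mult_ac)
  finally show ?thesis
    by (simp add: field_simps)
qed

text \<open>Here \<open>b \<le> k * t / 32\<close> with \<open>t\<close> the power of
  \<open>2 * n\<close>. In \<open>b ^ k / fact k\<close> the constant 32 beats \<open>exp 1\<close>,
  and \<open>t ^ k\<close> beats the number of events, at most \<open>n + n^2\<close> for vertices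
  and edges together.\<close>

lemma few_hits_numerics:
  fixes x :: real and n b k :: nat
  assumes n: "1 \<le> n" and x: "0 < x" and k: "x / 64 \<le> real k"
    and b: "real b \<le> x / 2048 * (2 * real n) powr (- (512 / x))"
  shows "(n + n\<^sup>2) * b ^ k < fact k"
proof -
  define t where "t = (2 * real n) powr (- (512 / x))"
  have t: "0 < t" using n by (simp add: t_def)
  have "real b \<le> x / 64 * (t / 32)" using b by (simp add: t_def)
  also have "\<dots> \<le> real k * (t / 32)" using k t by (intro mult_right_mono) auto
  finally have "real b ^ k \<le> (real k * (t / 32)) ^ k"
    by (rule power_mono) simp
  also have "\<dots> = real k ^ k * (t / 32) ^ k"
    by (rule power_mult_distrib)
  also have "\<dots> \<le> exp (real k) * fact k * (t / 32) ^ k"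
    using power_self_le_exp_fact t by (intro mult_right_mono) auto
  also have "\<dots> = fact k * ((exp 1 / 32) ^ k * t ^ k)"
    by (simp add: power_divide exp_of_nat_mult[symmetric] flip: exp_of_nat_mult)
  also have "\<dots> \<le> fact k * (1 * (1 / (4 * real n ^ 2)))"
  proof (intro mult_left_mono mult_mono)
    have "exp 1 \<le> (3::real)" by (rule exp_le)
    then show "(exp 1 / 32) ^ k \<le> (1::real)"
      by (intro power_le_one) auto
    have "t ^ k = (2 * real n) powr (- (512 / x) * real k)"
      using n by (simp add: t_def powr_power mult_ac)
    also have "\<dots> \<le> (2 * real n) powr (- 2)"
    proof (rule powr_mono)
      \<comment> \<open>The left-hand side is 8, so the exponent is in fact at most -8.\<close>
      have "512 / x * (x / 64) \<le> 512 / x * real k"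
        using k x by (intro mult_left_mono) auto
      then show "- (512 / x) * real k \<le> - 2" using x by simp
    qed (use n in simp)
    also have "\<dots> = inverse ((2 * real n) powr 2)"
      by (rule powr_minus)
    also have "\<dots> = 1 / (4 * real n ^ 2)"
      using n by (simp add: power_mult_distrib inverse_eq_divide)
    finally show "t ^ k \<le> 1 / (4 * real n ^ 2)" .
  qed (use t in auto)
  finally have "real b ^ k * (4 * real n ^ 2) \<le> fact k"
    using n by (simp add: field_simps)
  then have "real (b ^ k * (4 * n\<^sup>2)) \<le> real (fact k)" by simp
  then have le: "b ^ k * (4 * n\<^sup>2) \<le> fact k" by (simp only: of_nat_le_iff)
  \<comment> \<open>Strictness comes from \<open>n + n^2 < 4 * n^2\<close>, which gives nothing if
    \<open>b ^ k\<close> vanishes; then \<open>fact k\<close> is still positive.\<close>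
  show ?thesis
  proof (cases "b ^ k = 0")
    case True
    then show ?thesis by (simp only: mult_0_right fact_gt_zero)
  next
    case False
    have "n + n\<^sup>2 < 4 * n\<^sup>2" using n by (cases n) (auto simp: power2_eq_square)
    then have "(n + n\<^sup>2) * b ^ k < 4 * n\<^sup>2 * b ^ k"
      using False by (intro mult_strict_right_mono) auto
    also have "\<dots> \<le> fact k" using le by (simp only: mult.commute)
    finally show ?thesis .
  qed
qed

theorem theorem1p1:
  fixes V :: "'a set" and E :: "'a set set" and d s n :: nat
    and h :: "'a set \<Rightarrow> nat" and L :: "'a set \<Rightarrow> nat set" and \<beta> :: real
  assumes "simple_graph V E"
    and "edge_colorable V E d s"
    and "card V = n"
    and "standard_coloring E d s h"
    and "list_assignment E d L"
    and "beta_sparse V E d s h \<beta> L"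
    and "s \<ge> 11"
    and "\<beta> \<le> (1 / 2 ^ 11) * real s * (1 / real d)
               * (2 * real n) powr (- (2 ^ 9 * real d * (1 / (real s)\<^sup>2)))"
  shows "\<exists>\<phi>. proper_edge_coloring E d \<phi> \<and> avoids E \<phi> L"
proof (cases "\<forall>e\<in>E. L e = {}")
  case True
  then have "proper_edge_coloring E d h \<and> avoids E h L"
    using assms(4) by (simp add: standard_coloring_def avoids_def)
  then show ?thesis by blast
next
  case False
  then obtain e0 where e0: "e0 \<in> E" "L e0 \<noteq> {}" by blast
  interpret edge_coloured_graph V E d h
    using assms(1,2,4) by unfold_locales (auto simp: edge_colorable_def standard_coloring_def)
  have L_sub: "L e \<subseteq> {1..d}" if "e \<in> E" for e
    using assms(5) that by (simp add: list_assignment_def)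
  have finite_L: "finite (L e)" if "e \<in> E" for e
    by (rule finite_subset[OF L_sub[OF that]]) simp
  have "e0 \<noteq> {}" using edge_card[OF e0(1)] by auto
  then have "V \<noteq> {}" using edge_subset[OF e0(1)] by auto
  then have "0 < card V" using finite_V by (simp add: card_gt_0_iff)
  then have n: "1 \<le> n" using assms(3) by simp
  \<comment> \<open>The \<open>s - 1\<close> or more switchable colours of \<open>e0\<close> all
    differ from \<open>h e0\<close>, whence \<open>s \<le> d\<close>.\<close>
  have "switchable e0 \<subseteq> {1..d} - {h e0}" by (auto simp: switchable_def)
  then have "card (switchable e0) \<le> card ({1..d} - {h e0})" by (rule card_mono[rotated]) simp
  then have "s \<le> d"
    using card_switchable[OF assms(4) e0(1)] colour_range[OF e0(1)] assms(7) by simp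
  define x where "x = (real s)\<^sup>2 / real d"
  define t where "t = (2 * real n) powr (- (512 / x))"
  define b where "b = nat \<lfloor>\<beta> * real s\<rfloor>"
  define k where "k = nat \<lceil>x / 64\<rceil>"
  have sd: "0 < real s" "0 < real d" using assms(7) \<open>s \<le> d\<close> by auto
  have x: "0 < x" using sd by (simp add: x_def)
  have "x \<le> real s"
    using \<open>s \<le> d\<close> sd by (simp add: x_def power2_eq_square field_simps)
  have exponent: "- (2 ^ 9 * real d * (1 / (real s)\<^sup>2)) = - (512 / x)"
    using sd by (simp add: x_def)
  have "\<beta> * real s \<le> (1 / 2 ^ 11) * real s * (1 / real d) * t * real s"
    using assms(8) sd unfolding exponent t_def by (intro mult_right_mono) auto
  also have "\<dots> = x / 2048 * t"
    by (simp add: x_def power2_eq_square mult_ac)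
  finally have \<beta>s: "\<beta> * real s \<le> x / 2048 * t" .
  have "(2 * real n) powr (- (512 / x)) \<le> (2 * real n) powr 0"
    using n x by (intro powr_mono) auto
  then have t: "0 < t" "t \<le> 1" using n by (simp_all add: t_def)
  have "1 \<le> real (card (L e0))" using e0(2) finite_L[OF e0(1)] by (simp add: Suc_le_eq card_gt_0_iff)
  also have "\<dots> \<le> \<beta> * real s" using assms(6) e0(1) by (simp add: beta_sparse_def)
  finally have \<beta>s1: "1 \<le> \<beta> * real s" .
  \<comment> \<open>The nonempty list at \<open>e0\<close> enters here:
    \<open>1 \<le> \<beta> * s \<le> x / 2048\<close> makes \<open>x\<close> large enough to absorb
    the rounding in \<open>k\<close>.\<close>
  have "x / 2048 * t \<le> x / 2048" using t x by (simp add: mult_left_le)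
  then have x_ge: "2048 \<le> x" and b_le: "real b \<le> x / 2048 * t" "real b \<le> x / 2048"
    using \<beta>s \<beta>s1 by (simp_all add: b_def) linarith+
  have k: "x / 64 \<le> real k" "real k \<le> x / 64 + 1" using x unfolding k_def by linarith+
  have to_b: "m \<le> b" if "real m \<le> \<beta> * real s" for m :: nat
    using that unfolding b_def by linarith
  have L: "L e \<subseteq> {1..d} \<and> card (L e) \<le> b" if "e \<in> E" for e
    using assms(6) that L_sub to_b by (simp add: beta_sparse_def)
  \<comment> \<open>Left indices are the events at vertices, right indices those at edges. The empty
    target for colours that are not switchable allows hits to be counted over all of
    \<open>{1..d}\<close> in both cases.\<close>
  define A where "A = case_sum (\<lambda>v c. L {v, partner c v})
      (\<lambda>e c. if c \<in> switchable e then L (partner c ` e) else {})"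
  have "E \<subseteq> (\<lambda>(u, v). {u, v}) ` (V \<times> V)"
  proof
    fix e assume e: "e \<in> E"
    then obtain u v where "e = {u, v}" using edge_card[OF e] by (auto simp: card_2_iff)
    then show "e \<in> (\<lambda>(u, v). {u, v}) ` (V \<times> V)" using edge_subset[OF e] by auto
  qed
  then have "card E \<le> card (V \<times> V)"
    using finite_V by (intro surj_card_le) auto
  then have cardI: "card (V <+> E) \<le> n + n\<^sup>2"
    using finite_V finite_E assms(3) by (simp add: card_Plus power2_eq_square card_cartesian_product)
  have "\<exists>\<rho>. \<rho> permutes {1..d} \<and> (\<forall>i\<in>V <+> E. card {c \<in> {1..d}. \<rho> c \<in> A i c} < k)"
  proof (rule ex_permutation_few_hits[where b = b])
    show "card (V <+> E) * b ^ k < fact k"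
      by (rule le_less_trans[OF mult_le_mono1[OF cardI]
            few_hits_numerics[OF n x k(1) b_le(1)[unfolded t_def]]])
    fix i c assume "i \<in> V <+> E" "c \<in> {1..d}"
    then show "finite (A i c) \<and> card (A i c) \<le> b"
      using L finite_L partner_edge(1) by (auto simp: A_def switchable_def)
  qed (use finite_V finite_E in auto)
  then obtain \<rho> where \<rho>: "\<rho> permutes {1..d}"
    "\<And>i. i \<in> V <+> E \<Longrightarrow> card {c \<in> {1..d}. \<rho> c \<in> A i c} < k" by blast
  show ?thesis
  proof (rule ex_repaired_colouring[OF \<rho>(1) L])
    show "card {e \<in> incident_edges E v. c \<in> L e} \<le> b" if "v \<in> V" "c \<in> {1..d}" for v c
      using assms(6) that by (intro to_b) (simp add: beta_sparse_def)
    show "card {e \<in> E. h e = h f \<and> e \<in> edge_nbhd E 6 f \<and> c \<in> L e} \<le> b"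
      if f: "f \<in> E" "c \<in> {1..d}" for f c
    proof -
      have "standard_matching E d h {e \<in> E. h e = h f}"
        using colour_range[OF f(1)] by (auto simp: standard_matching_def)
      then have "real (card {e \<in> {e \<in> E. h e = h f} \<inter> edge_nbhd E 6 f. c \<in> L e}) \<le> \<beta> * real s"
        using assms(6) f unfolding beta_sparse_def by blast
      moreover have "{e \<in> {e \<in> E. h e = h f} \<inter> edge_nbhd E 6 f. c \<in> L e}
          = {e \<in> E. h e = h f \<and> e \<in> edge_nbhd E 6 f \<and> c \<in> L e}" by auto
      ultimately show ?thesis using to_b by simp
    qed
    show "card {c \<in> {1..d}. \<rho> c \<in> L {v, partner c v}} \<le> k" if "v \<in> V" for v
      using \<rho>(2)[of "Inl v"] that by (simp add: A_def InlI)
    show "card {c \<in> switchable e. \<rho> c \<in> L (partner c ` e)} \<le> k" if "e \<in> E" for e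
    proof -
      have "{c \<in> switchable e. \<rho> c \<in> L (partner c ` e)} = {c \<in> {1..d}. \<rho> c \<in> A (Inr e) c}"
        by (auto simp: A_def switchable_def)
      then show ?thesis using \<rho>(2)[of "Inr e"] that by (simp add: InrI)
    qed
    show "s - 1 \<le> card (switchable e)" if "e \<in> E" for e
      using card_switchable[OF assms(4) that] .
    \<comment> \<open>\<open>27 * (x / 64 + 1) + 29 * x / 2048\<close> equals
      \<open>893 * x / 2048 + 27\<close>, which is below \<open>x\<close> for
      \<open>x \<ge> 2048\<close>.\<close>
    have "real (27 * k + 29 * b) < real s"
      using k(2) b_le(2) x_ge \<open>x \<le> real s\<close> by simp
    then show "27 * k + 29 * b < s" by (simp only: of_nat_less_iff)
    show "0 < k" using k(1) x by linarith
  qed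
qed

end
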